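(* Let $w\in S_\infty$, let $\mathfrak{G}_w$ be its Grothendieck polynomial, and let $\lambda(w)$ be its effective region. Then $\deg(\mathfrak{G}_w)\leq|\lambda(w)|$, with equality if and only if $w$ is dominant.
   Context: $S_\infty=\bigcup_{n\geq1}S_n$, where $w\in S_n$ is identified with the permutation in $S_{n'}$ ($n'>n$) that agrees with $w$ on $\{1,\dots,n\}$ and fixes all $i>n$. For $w\in S_n$, with $[n]=\{1,\dots,n\}$, the Rothe diagram is $D(w)=\{(i,j)\in[n]\times[n]: j<w(i),\ i<w^{-1}(j)\}$ (this does not depend on the choice of $n$). The essential set is $E(w)=\{(i,j)\in D(w): (i,j+1)\notin D(w)\text{ and }(i+1,j)\notin D(w)\}$. The effective region $\lambda(w)$ is the set of $(i,j)$ with $i,j\geq1$ such that $i\leq i'$ and $j\leq j'$ for some $(i',j')\in E(w)$. The permutation $w$ is dominant if $\lambda(w)=D(w)$. The Coxeter length is $\ell(w)=\#\{i<j:w(i)>w(j)\}$. Let $t_{a\leftrightarrow b}$ be the transposition interchanging $a$ and $b$, so that $wt_{a\leftrightarrow b}$ swaps the positions $a$ and $b$ of $w$. A descent of $w$ is an index $i$ with $w(i)>w(i+1)$, equivalently $\ell(wt_{i\leftrightarrow i+1})<\ell(w)$. The Grothendieck polynomials $\mathfrak{G}_w=\mathfrak{G}_w(x_1,x_2,\dots)$, $w\in S_\infty$ (due to Lascoux and Schützenberger), are polynomials with integer coefficients in commuting variables $x_1,x_2,\dots$, uniquely determined by $\mathfrak{G}_{id}=1$ and the following recursion (Lascoux's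 transition formula). For $w\neq id$, let $g$ be the last descent of $w$, let $m>g$ be the largest integer with $w(m)<w(g)$, set $w'=wt_{g\leftrightarrow m}$, and let $1\leq i_1<i_2<\dots<i_s<g$ be the indices $i$ such that $\ell(w't_{i\leftrightarrow g})=\ell(w')+1$. Then $$\mathfrak{G}_w=\mathfrak{G}_{w'}+(x_g-1)\big[\mathfrak{G}_{w'}\cdot(\mathsf{Id}-t_{i_1\leftrightarrow g})\cdots(\mathsf{Id}-t_{i_s\leftrightarrow g})\big],$$ where $\mathsf{Id}$ is the identity operator and the operators act on the right, linearly on the Grothendieck polynomials, by $\mathfrak{G}_u\cdot t_{j\leftrightarrow l}=\mathfrak{G}_{ut_{j\leftrightarrow l}}$. The degree $\deg(\mathfrak{G}_w)$ is the total degree, i.e. the largest degree of a monomial appearing in $\mathfrak{G}_w$, with each $x_i$ of degree $1$. *)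

theory Defs
  imports "HOL-Library.Poly_Mapping" "HOL-Combinatorics.Permutations"
begin

text \<open>
  Elements of \<open>S\<^sub>\<infinity>\<close> are functions on \<^typ>\<open>nat\<close> that permute some \<open>{1..n}\<close> and fix everything else,
  in particular the junk index 0.  With this encoding \<open>S\<^sub>n \<subseteq> S\<^sub>n\<^sub>'\<close> holds literally and \<open>w t\<^bsub>a\<leftrightarrow>b\<^esub>\<close>
  is \<^term>\<open>w \<circ> transpose a b\<close>.
\<close>

type_synonym perm = "nat \<Rightarrow> nat"

definition S_infty :: "perm set" where
  "S_infty = {w. \<exists>n\<ge>1. w permutes {1..n}}"

text \<open>
  The bounds \<open>i \<le> n\<close> and \<open>j \<le> n\<close> are omitted from the Rothe diagram: they are implied whenever
  \<open>w \<in> S\<^sub>n\<close>; see \<open>rothe_diagram_bounded\<close>.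
\<close>

definition rothe_diagram :: "perm \<Rightarrow> (nat \<times> nat) set" where
  "rothe_diagram w = {(i, j). 1 \<le> i \<and> 1 \<le> j \<and> j < w i \<and> i < inv w j}"

definition essential_set :: "perm \<Rightarrow> (nat \<times> nat) set" where
  "essential_set w =
     {(i, j) \<in> rothe_diagram w. (i, j + 1) \<notin> rothe_diagram w \<and> (i + 1, j) \<notin> rothe_diagram w}"

definition effective_region :: "perm \<Rightarrow> (nat \<times> nat) set" where
  "effective_region w =
     {(i, j). 1 \<le> i \<and> 1 \<le> j \<and> (\<exists>(i', j') \<in> essential_set w. i \<le> i' \<and> j \<le> j')}"

definition dominant :: "perm \<Rightarrow> bool" where
  "dominant w \<longleftrightarrow> effective_region w = rothe_diagram w"

lemma rothe_diagram_bounded: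
  assumes "w permutes {1..n}"
  shows "rothe_diagram w = {(i, j) \<in> {1..n} \<times> {1..n}. j < w i \<and> i < inv w j}"
proof -
  have iw: "inv w permutes {1..n}" using assms by (rule permutes_inv)
  have "i \<le> n \<and> j \<le> n" if "1 \<le> i" "1 \<le> j" "j < w i" "i < inv w j" for i j
  proof -
    have wi: "w i = i" if "i > n" using permutes_not_in[OF assms, of i] that by auto
    have wj: "inv w j = j" if "j > n" using permutes_not_in[OF iw, of j] that by auto
    have wi': "w i \<le> n" if "i \<le> n"
      using permutes_in_image[OF assms, of i] that \<open>1 \<le> i\<close> by auto
    have wj': "inv w j \<le> n" if "j \<le> n"
      using permutes_in_image[OF iw, of j] that \<open>1 \<le> j\<close> by auto
    show ?thesis
      using wi wj wi' wj' that(3,4) by linarith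
  qed
  then show ?thesis by (auto simp: rothe_diagram_def)
qed

lemma finite_effective_region:
  assumes "w \<in> S_infty"
  shows "finite (effective_region w)"
proof -
  obtain n where "w permutes {1..n}" using assms by (auto simp: S_infty_def)
  then have "essential_set w \<subseteq> {1..n} \<times> {1..n}"
    by (auto simp: essential_set_def rothe_diagram_bounded)
  then have "effective_region w \<subseteq> {1..n} \<times> {1..n}"
    unfolding effective_region_def by auto
  then show ?thesis by (rule finite_subset) simp
qed

definition coxeter_length :: "perm \<Rightarrow> nat" where
  "coxeter_length w = card {(i, j). 1 \<le> i \<and> i < j \<and> w i > w j}"

definition last_descent :: "perm \<Rightarrow> nat" where
  "last_descent w = Max {i. 1 \<le> i \<and> w i > w (i + 1)}"

definition last_smaller :: "perm \<Rightarrow> nat" where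
  "last_smaller w = Max {m. last_descent w < m \<and> w m < w (last_descent w)}"

definition transition_perm :: "perm \<Rightarrow> perm" where
  "transition_perm w = w \<circ> transpose (last_descent w) (last_smaller w)"

definition transition_indices :: "perm \<Rightarrow> nat list" where
  "transition_indices w =
     (let g = last_descent w; w' = transition_perm w in
      sorted_list_of_set
        {i. 1 \<le> i \<and> i < g \<and> coxeter_length (w' \<circ> transpose i g) = coxeter_length w' + 1})"

text \<open>
  Polynomials over \<open>\<int>\<close> in variables indexed by \<^typ>\<open>nat\<close>; Grothendieck polynomials do not
  involve the variable of index 0.
\<close>

type_synonym int_mpoly = "(nat \<Rightarrow>\<^sub>0 nat) \<Rightarrow>\<^sub>0 int"

definition mvar :: "nat \<Rightarrow> int_mpoly" where
  "mvar i = Poly_Mapping.single (Poly_Mapping.single i 1) 1"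

text \<open>The zero polynomial is given degree 0.\<close>

definition total_degree :: "int_mpoly \<Rightarrow> nat" where
  "total_degree p = Max (insert 0 ((\<lambda>m. \<Sum>i\<in>Poly_Mapping.keys m. Poly_Mapping.lookup m i) ` Poly_Mapping.keys p))"

text \<open>
  For \<open>F\<close> in the role of \<open>u \<mapsto> \<GG>\<^sub>u\<close>, the value of \<open>transition_op g [i\<^sub>1, \<dots>, i\<^sub>s] F u\<close> is
  \<open>\<GG>\<^sub>u \<cdot> (Id - t\<^bsub>i\<^sub>1\<leftrightarrow>g\<^esub>) \<cdots> (Id - t\<^bsub>i\<^sub>s\<leftrightarrow>g\<^esub>)\<close>; the leftmost factor acts first, and by linearity the
  remaining ones are then applied to each of \<open>\<GG>\<^sub>u\<close> and \<open>\<GG>\<^bsub>u t\<^esub>\<close>.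
\<close>

primrec transition_op :: "nat \<Rightarrow> nat list \<Rightarrow> (perm \<Rightarrow> int_mpoly) \<Rightarrow> perm \<Rightarrow> int_mpoly" where
  "transition_op g [] F u = F u"
| "transition_op g (i # ks) F u = transition_op g ks F u - transition_op g ks F (u \<circ> transpose i g)"

text \<open>
  The remaining material up to the definition of the Grothendieck polynomials serves only to
  establish termination of the transition recursion: \<open>(g, #{j > g. w j < w g})\<close>, with \<open>g\<close> the last
  descent of \<open>w\<close>, decreases lexicographically.
\<close>

primrec transition_reach :: "nat \<Rightarrow> nat list \<Rightarrow> perm \<Rightarrow> perm set" where
  "transition_reach g [] u = {u}"
| "transition_reach g (i # ks) u =
     transition_reach g ks u \<union> transition_reach g ks (u \<circ> transpose i g)"

lemma transition_op_cong [fundef_cong]: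
  assumes "g = g'" "ks = ks'" "u = u'"
    and "\<And>v. v \<in> transition_reach g' ks' u' \<Longrightarrow> F v = F' v"
  shows "transition_op g ks F u = transition_op g' ks' F' u'"
  using assms(4) unfolding assms(1-3) by (induction ks' arbitrary: u') auto

lemma S_infty_compose_transpose:
  assumes "w \<in> S_infty" "a \<ge> 1" "b \<ge> 1"
  shows "w \<circ> transpose a b \<in> S_infty"
proof -
  obtain n where n: "n \<ge> 1" "w permutes {1..n}" using assms(1) by (auto simp: S_infty_def)
  define k where "k = max n (max a b)"
  have "w permutes {1..k}" using permutes_subset[OF n(2)] by (auto simp: k_def)
  moreover have "transpose a b permutes {1..k}"
    using assms by (intro permutes_swap_id) (auto simp: k_def)
  ultimately have "w \<circ> transpose a b permutes {1..k}" by (intro permutes_compose)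
  then show ?thesis using n(1) unfolding S_infty_def
    by (intro CollectI exI[of _ k]) (simp add: k_def)
qed

lemma S_infty_inj: "w \<in> S_infty \<Longrightarrow> inj w"
  by (auto simp: S_infty_def dest: permutes_inj)

lemma finite_inversions:
  assumes "w \<in> S_infty"
  shows "finite {(i, j). 1 \<le> i \<and> i < j \<and> w i > w j}"
proof -
  obtain n where n: "w permutes {1..n}" using assms by (auto simp: S_infty_def)
  have "j \<le> n" if "1 \<le> i" "i < j" "w i > w j" for i j
  proof (rule ccontr)
    assume "\<not> j \<le> n"
    then have "w j = j" using permutes_not_in[OF n] by auto
    with that permutes_in_image[OF n, of i] permutes_not_in[OF n, of i] show False
      by (cases "i \<le> n") (use \<open>\<not> j \<le> n\<close> in auto)
  qed
  then have "{(i, j). 1 \<le> i \<and> i < j \<and> w i > w j} \<subseteq> {..n} \<times> {..n}"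
    by (auto simp: subset_iff) (meson less_imp_le order.trans)
  then show ?thesis by (rule finite_subset) simp
qed

lemma coxeter_length_transpose_le:
  assumes w: "w \<in> S_infty" and ij: "1 \<le> i" "i < j" "w i > w j"
  shows "coxeter_length (w \<circ> transpose i j) \<le> coxeter_length w"
proof -
  let ?t = "transpose i j"
  let ?I = "\<lambda>w::perm. {(a, b). 1 \<le> a \<and> a < b \<and> w a > w b}"
  let ?f = "\<lambda>(a, b). if ?t a < ?t b then (?t a, ?t b) else (a, b)"
  have "inj_on ?f (?I (w \<circ> ?t))"
  proof (rule inj_onI)
    fix x y assume "x \<in> ?I (w \<circ> ?t)" "y \<in> ?I (w \<circ> ?t)" and eq: "?f x = ?f y"
    then obtain a b c d where xy: "x = (a, b)" "y = (c, d)" "a < b" "c < d" by auto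
    have t: "?t (?t k) = k" for k by (rule transpose_involutory)
    show "x = y"
    proof (cases "?t a < ?t b"; cases "?t c < ?t d")
      assume "?t a < ?t b" "?t c < ?t d"
      with eq xy have "?t a = ?t c" "?t b = ?t d" by simp_all
      then show ?thesis using t xy by metis
    next
      assume "?t a < ?t b" "\<not> ?t c < ?t d"
      with eq xy have "?t a = c" "?t b = d" by simp_all
      then show ?thesis using t[of a] t[of b] xy \<open>\<not> ?t c < ?t d\<close> by simp
    next
      assume "\<not> ?t a < ?t b" "?t c < ?t d"
      with eq xy have "a = ?t c" "b = ?t d" by simp_all
      then show ?thesis using t[of c] t[of d] xy \<open>\<not> ?t a < ?t b\<close> by simp
    next
      assume "\<not> ?t a < ?t b" "\<not> ?t c < ?t d"
      with eq xy show ?thesis by simp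
    qed
  qed
  moreover have "?f ` ?I (w \<circ> ?t) \<subseteq> ?I w"
    using ij by (auto split: if_splits simp: transpose_def)
  ultimately show ?thesis
    using finite_inversions[OF w] unfolding coxeter_length_def by (intro card_inj_on_le)
qed

lemma no_descent_imp_id:
  assumes w: "w \<in> S_infty" and inc: "\<And>i. 1 \<le> i \<Longrightarrow> \<not> w i > w (i + 1)"
  shows "w = id"
proof -
  obtain n where n: "w permutes {1..n}" using w by (auto simp: S_infty_def)
  have step: "w i < w (Suc i)" if "1 \<le> i" for i
    using inc[OF that] inj_eq[OF S_infty_inj[OF w], of i "Suc i"] by force
  have ge: "w i \<ge> i" for i
  proof (induction i)
    case (Suc i)
    have "w (Suc i) \<in> {1..n} \<or> w (Suc i) = Suc i"
      using permutes_in_image[OF n, of "Suc i"] permutes_not_in[OF n, of "Suc i"] by blast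
    with Suc step[of i] show ?case by (cases "i = 0") auto
  qed simp
  have "w i = i" for i
  proof (rule ccontr)
    assume "w i \<noteq> i"
    with ge[of i] have lt: "i < w i" by simp
    have i: "i \<in> {1..n}" using lt permutes_not_in[OF n] by force
    have "k < w k" if "i \<le> k" for k
      using that
    proof (induction k rule: dec_induct)
      case (step k)
      with i \<open>\<And>i. 1 \<le> i \<Longrightarrow> w i < w (Suc i)\<close>[of k] show ?case by auto
    qed (use lt in simp)
    from this[of "Suc n"] show False using i permutes_not_in[OF n, of "Suc n"] by auto
  qed
  then show ?thesis by auto
qed

lemma finite_descents:
  assumes "w \<in> S_infty"
  shows "finite {i. 1 \<le> i \<and> w i > w (i + 1)}"
proof -
  have "{i. 1 \<le> i \<and> w i > w (i + 1)} \<subseteq> fst ` {(i, j). 1 \<le> i \<and> i < j \<and> w i > w j}"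
    by force
  then show ?thesis using finite_inversions[OF assms] by (meson finite_imageI finite_subset)
qed

lemma last_descent:
  assumes "w \<in> S_infty" "w \<noteq> id"
  shows "1 \<le> last_descent w" "w (last_descent w) > w (last_descent w + 1)"
    and "\<And>i. last_descent w < i \<Longrightarrow> w i < w (i + 1)"
proof -
  let ?D = "{i. 1 \<le> i \<and> w i > w (i + 1)}"
  have fin: "finite ?D" by (rule finite_descents[OF assms(1)])
  have "?D \<noteq> {}" using no_descent_imp_id[OF assms(1)] assms(2) by auto
  then have "Max ?D \<in> ?D" using fin by (rule Max_in[rotated])
  then show "1 \<le> last_descent w" "w (last_descent w) > w (last_descent w + 1)"
    by (auto simp: last_descent_def)
  fix i assume i: "last_descent w < i"
  then have "i \<notin> ?D" using Max_ge[OF fin, of i] by (auto simp: last_descent_def)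
  with i inj_eq[OF S_infty_inj[OF assms(1)], of i "i + 1"] show "w i < w (i + 1)" by force
qed

lemma last_smaller:
  assumes "w \<in> S_infty" "w \<noteq> id"
  shows "last_descent w < last_smaller w" "w (last_smaller w) < w (last_descent w)"
    and "\<And>m. last_smaller w < m \<Longrightarrow> w m > w (last_descent w)"
    and "finite {m. last_descent w < m \<and> w m < w (last_descent w)}"
proof -
  let ?M = "{m. last_descent w < m \<and> w m < w (last_descent w)}"
  have "?M \<subseteq> snd ` {(i, j). 1 \<le> i \<and> i < j \<and> w i > w j}"
    using last_descent(1)[OF assms] by force
  then show fin: "finite ?M"
    using finite_inversions[OF assms(1)] by (meson finite_imageI finite_subset)
  have "last_descent w + 1 \<in> ?M" using last_descent(2)[OF assms] by simp
  then have "Max ?M \<in> ?M" using fin by (intro Max_in) auto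
  then show lt: "last_descent w < last_smaller w" "w (last_smaller w) < w (last_descent w)"
    by (auto simp: last_smaller_def)
  fix m assume m: "last_smaller w < m"
  then have "m \<notin> ?M" using Max_ge[OF fin, of m] by (auto simp: last_smaller_def)
  with m lt inj_eq[OF S_infty_inj[OF assms(1)], of m "last_descent w"]
  show "w m > w (last_descent w)" by force
qed

definition transition_measure :: "perm \<Rightarrow> nat" where
  "transition_measure w =
     (if w = id then 0 else card {m. last_descent w < m \<and> w m < w (last_descent w)})"

definition descent_measure :: "perm \<Rightarrow> nat" where
  "descent_measure w = (if w = id then 0 else last_descent w)"

lemma transition_decreases:
  assumes w: "w \<in> S_infty" "w \<noteq> id" and u: "u \<in> S_infty"
    and after: "\<And>j. last_descent w < j \<Longrightarrow> u j = transition_perm w j"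
    and at: "u (last_descent w) \<le> transition_perm w (last_descent w)"
  shows "(u, w) \<in> measures [descent_measure, transition_measure]"
proof (cases "u = id")
  case True
  then show ?thesis using w last_descent(1)[OF w] by (simp add: descent_measure_def)
next
  case False
  define g m where gm: "g = last_descent w" "m = last_smaller w"
  note ld = last_descent[OF w, folded gm] and ls = last_smaller[OF w, folded gm]
  have w': "transition_perm w = w \<circ> transpose g m" by (simp add: transition_perm_def gm)
  have um: "u m = w g" using after[of m] ls(1) gm by (simp add: w')
  have uj: "u j = w j" if "g < j" "j \<noteq> m" for j using after[of j] that gm by (simp add: w')
  have ug: "u g \<le> w m" using at by (simp add: w' flip: gm)
  have inc: "u j < u (j + 1)" if j: "g < j" for j
  proof -
    consider "j = m" | "j + 1 = m" | "j \<noteq> m" "j + 1 \<noteq> m" by blast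
    then show ?thesis
    proof cases
      case 1
      then show ?thesis using um uj[of "j + 1"] j ls(3)[of "j + 1"] by simp
    next
      case 2
      then show ?thesis using um uj[of j] j ld(3)[of j] ls(2) by simp
    next
      case 3
      then show ?thesis using uj[of j] uj[of "j + 1"] j ld(3)[of j] by simp
    qed
  qed
  have le: "last_descent u \<le> g"
    using last_descent(2)[OF u False] inc[of "last_descent u"] by (force simp: not_le[symmetric])
  have "transition_measure u < transition_measure w" if eq: "last_descent u = g"
  proof -
    let ?B = "{k. g < k \<and> w k < w g}"
    have "{k. g < k \<and> u k < u g} \<subseteq> ?B - {m}"
    proof
      fix k assume k: "k \<in> {k. g < k \<and> u k < u g}"
      have "k \<noteq> m" using k um ug ls(2) by auto
      then show "k \<in> ?B - {m}" using k uj[of k] ug ls(2) by auto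
    qed
    then have "card {k. g < k \<and> u k < u g} < card ?B"
      using ls by (intro psubset_card_mono) auto
    then show ?thesis using False w(2) eq by (simp add: transition_measure_def flip: gm)
  qed
  then show ?thesis using le False w(2) by (auto simp: descent_measure_def simp flip: gm)
qed

lemma transition_perm_in_S_infty:
  assumes "w \<in> S_infty" "w \<noteq> id"
  shows "transition_perm w \<in> S_infty"
  using last_descent(1)[OF assms] last_smaller(1)[OF assms]
  unfolding transition_perm_def by (intro S_infty_compose_transpose assms) auto

lemma transition_indices_less:
  assumes w: "w \<in> S_infty" "w \<noteq> id" and i: "i \<in> set (transition_indices w)"
  shows "1 \<le> i" "i < last_descent w"
    and "transition_perm w i < transition_perm w (last_descent w)"
proof -
  let ?g = "last_descent w" and ?w' = "transition_perm w"
  let ?I = "{i. 1 \<le> i \<and> i < ?g \<and> coxeter_length (?w' \<circ> transpose i ?g) = coxeter_length ?w' + 1}"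
  have "finite ?I" by (rule finite_subset[of _ "{..<?g}"]) auto
  with i have I: "i \<in> ?I" by (simp add: transition_indices_def Let_def)
  then show 1: "1 \<le> i" "i < ?g" by auto
  have S: "?w' \<in> S_infty" using transition_perm_in_S_infty[OF w] .
  show "?w' i < ?w' ?g"
  proof (rule ccontr)
    assume "\<not> ?w' i < ?w' ?g"
    then have "?w' i > ?w' ?g"
      using 1 inj_eq[OF S_infty_inj[OF S], of i ?g] by force
    from coxeter_length_transpose_le[OF S 1 this] I show False by simp
  qed
qed

lemma transition_reach_props:
  assumes "v \<in> transition_reach g ks u" "u \<in> S_infty" "sorted_wrt (<) ks"
    and "\<forall>i\<in>set ks. 1 \<le> i \<and> i < g \<and> u i = r i \<and> r i < c" "u g \<le> c"
  shows "v \<in> S_infty \<and> (\<forall>j>g. v j = u j) \<and> v g \<le> c"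
  using assms
proof (induction ks arbitrary: u)
  case (Cons i ks)
  let ?u = "u \<circ> transpose i g"
  from Cons.prems(1) consider "v \<in> transition_reach g ks u" | "v \<in> transition_reach g ks ?u"
    by auto
  then show ?case
  proof cases
    case 1
    then show ?thesis using Cons.IH[of u] Cons.prems by simp
  next
    case 2
    have "?u \<in> S_infty" using Cons.prems by (intro S_infty_compose_transpose) auto
    moreover have "\<forall>k\<in>set ks. 1 \<le> k \<and> k < g \<and> ?u k = r k \<and> r k < c"
      using Cons.prems by (auto simp: transpose_def)
    moreover have "?u g \<le> c" "\<forall>j>g. ?u j = u j" using Cons.prems by (auto simp: transpose_def)
    ultimately show ?thesis using Cons.IH[OF 2] Cons.prems(3) by (metis sorted_wrt.simps(2))
  qed
qed simp

lemma sorted_transition_indices: "sorted_wrt (<) (transition_indices w)"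
  by (simp add: transition_indices_def Let_def)

text \<open>Outside \<open>S\<^sub>\<infinity>\<close> the value is the dummy 0.\<close>

function grothendieck :: "perm \<Rightarrow> int_mpoly" where
  "grothendieck w =
     (if w \<notin> S_infty then 0
      else if w = id then 1
      else let g = last_descent w; w' = transition_perm w in
        grothendieck w' + (mvar g - 1) * transition_op g (transition_indices w) grothendieck w')"
  by pat_completeness auto
termination
proof (relation "measures [descent_measure, transition_measure]", goal_cases)
  case 1
  show ?case by simp
next
  case (2 w g w')
  then show ?case
    using transition_perm_in_S_infty by (intro transition_decreases) auto
next
  case (3 w g w' v)
  then have w: "w \<in> S_infty" "w \<noteq> id" by auto
  have "v \<in> S_infty \<and> (\<forall>j>g. v j = w' j) \<and> v g \<le> w' g"
    using 3 transition_perm_in_S_infty[OF w] transition_indices_less[OF w]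
    by (intro transition_reach_props[where r = w' and ks = "transition_indices w"]
          sorted_transition_indices) auto
  then show ?case using 3 by (intro transition_decreases[OF w]) auto
qed

declare grothendieck.simps [simp del]

lemma grothendieck_id: "grothendieck id = 1"
proof -
  have "id \<in> S_infty" using permutes_id by (auto simp: S_infty_def)
  then show ?thesis by (simp add: grothendieck.simps)
qed

lemma grothendieck_transition:
  assumes "w \<in> S_infty" "w \<noteq> id"
  shows "grothendieck w =
    grothendieck (transition_perm w) +
      (mvar (last_descent w) - 1) *
        transition_op (last_descent w) (transition_indices w) grothendieck (transition_perm w)"
  using assms by (subst grothendieck.simps) (simp add: Let_def)

end

theory Submission
  imports Defs
begin

text \<open>
  Let \<open>g\<close> be the last descent of \<open>w\<close>, let \<open>w'\<close> be the transition permutation and put \<open>c = w' g\<close>.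
  The effective region \<open>\<lambda>(w)\<close> is the down-closure of the Rothe diagram \<open>D(w)\<close>, and \<open>(g, c)\<close> is
  the last box of the last nonempty row of \<open>D(w)\<close>; hence it is a corner of \<open>\<lambda>(w)\<close>.  The
  whole proof rests on how this corner behaves in the transition formula:

  \<^item> \<open>D(w')\<close> is \<open>D(w)\<close> with \<open>(g, c)\<close> removed (\<open>rothe_diagram_transition_perm\<close>).
  \<^item> Every permutation \<open>v\<close> whose Grothendieck polynomial occurs on the right-hand side of the
    formula agrees with \<open>w'\<close> except at some positions up to \<open>g\<close>, where its values are at most \<open>c\<close>.
    A box of \<open>D(v)\<close> therefore lies in \<open>D(w')\<close> or in the rectangle of rows up to \<open>g\<close> and columns
    up to \<open>c\<close>, but never at \<open>(g, c)\<close>, so \<open>\<lambda>(v)\<close> is contained in \<open>\<lambda>(w)\<close> without its corner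
    (\<open>effective_region_transition_reach\<close>).  If \<open>v \<noteq> w'\<close>, then moreover \<open>v g < c\<close>, so that \<open>\<lambda>(v)\<close> also misses the cell
    \<open>(g, c - 1)\<close> of \<open>\<lambda>(w)\<close>.

  If \<open>w\<close> is dominant, then so is \<open>w'\<close>.  An index \<open>i\<close> of the transition would have \<open>w i < c\<close> with
  \<open>i < g\<close>, so that \<open>(i, w i)\<close> lies in \<open>\<lambda>(w)\<close> but not in \<open>D(w)\<close>; thus there are none and
  \<open>\<GG>\<^sub>w = x\<^sub>g \<GG>\<^sub>w\<^sub>'\<close>.  By induction \<open>\<GG>\<^sub>w\<close> is a monomial of degree \<open>\<bar>\<lambda>(w)\<bar>\<close>.

  If \<open>w\<close> is not dominant, it suffices that \<open>deg \<GG>\<^sub>v + 1 < \<bar>\<lambda>(w)\<bar>\<close> for each \<open>v\<close> above, because \<open>x\<^sub>g - 1\<close>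
  raises the degree by one.  By induction \<open>deg \<GG>\<^sub>v \<le> \<bar>\<lambda>(v)\<bar>\<close>, strictly unless \<open>v\<close> is dominant, and
  \<open>\<bar>\<lambda>(v)\<bar> + 1 \<le> \<bar>\<lambda>(w)\<bar>\<close> as the corner is lost.  So only a dominant \<open>v\<close> can cause trouble.  For
  \<open>v \<noteq> w'\<close> the second lost box gives the strict inequality; for \<open>v = w'\<close> it comes from
  \<open>\<bar>\<lambda>(w')\<bar> + 1 = \<bar>D(w')\<bar> + 1 = \<bar>D(w)\<bar> < \<bar>\<lambda>(w)\<bar>\<close>.
\<close>

section \<open>Total degree\<close>

definition monomial_degree :: "(nat \<Rightarrow>\<^sub>0 nat) \<Rightarrow> nat" where
  "monomial_degree m = (\<Sum>i\<in>Poly_Mapping.keys m. Poly_Mapping.lookup m i)"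

lemma monomial_degree_add: "monomial_degree (a + b) = monomial_degree a + monomial_degree b"
proof -
  let ?A = "Poly_Mapping.keys a \<union> Poly_Mapping.keys b"
  have sup: "monomial_degree m = (\<Sum>i\<in>?A. Poly_Mapping.lookup m i)"
    if "Poly_Mapping.keys m \<subseteq> ?A" for m
    unfolding monomial_degree_def using that
    by (intro sum.mono_neutral_left) (auto simp: in_keys_iff)
  show ?thesis
    by (simp add: sup Poly_Mapping.keys_add lookup_add sum.distrib)
qed

lemma monomial_degree_single [simp]: "monomial_degree (Poly_Mapping.single i k) = k"
  by (simp add: monomial_degree_def)

lemma total_degree_le_iff:
  "total_degree p \<le> d \<longleftrightarrow> (\<forall>m\<in>Poly_Mapping.keys p. monomial_degree m \<le> d)"
  unfolding total_degree_def monomial_degree_def by (subst Max_le_iff) auto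

lemma total_degree_single: "total_degree (Poly_Mapping.single m 1) = monomial_degree m"
  by (simp add: total_degree_def monomial_degree_def)

lemma total_degree_add_le:
  assumes "total_degree p \<le> d" "total_degree q \<le> d"
  shows "total_degree (p + q) \<le> d"
  using assms Poly_Mapping.keys_add[of p q] unfolding total_degree_le_iff by blast

lemma total_degree_diff_le:
  assumes "total_degree p \<le> d" "total_degree q \<le> d"
  shows "total_degree (p - q) \<le> d"
  using assms keys_diff[of p q] unfolding total_degree_le_iff by blast

lemma total_degree_mult_le:
  assumes "total_degree p \<le> d" "total_degree q \<le> e"
  shows "total_degree (p * q) \<le> d + e"
  unfolding total_degree_le_iff
proof
  fix m assume "m \<in> Poly_Mapping.keys (p * q)"
  then obtain a b where "m = a + b" "a \<in> Poly_Mapping.keys p" "b \<in> Poly_Mapping.keys q"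
    using keys_mult[of p q] by blast
  then show "monomial_degree m \<le> d + e"
    using assms by (simp add: total_degree_le_iff monomial_degree_add add_mono)
qed

lemma total_degree_mvar_minus_one: "total_degree (mvar g - 1) \<le> 1"
proof (rule total_degree_diff_le)
  show "total_degree (mvar g) \<le> 1"
    by (simp add: mvar_def total_degree_single del: One_nat_def)
  show "total_degree 1 \<le> 1"
    by (simp add: total_degree_single monomial_degree_def flip: single_one)
qed

lemma total_degree_transition_op_le:
  assumes "\<And>v. v \<in> transition_reach g ks u \<Longrightarrow> total_degree (F v) \<le> d"
  shows "total_degree (transition_op g ks F u) \<le> d"
  using assms by (induction ks arbitrary: u) (auto intro: total_degree_diff_le)

section \<open>The effective region as a down-closure\<close>

lemma S_infty_zero: "w \<in> S_infty \<Longrightarrow> w 0 = 0"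
  by (auto simp: S_infty_def permutes_def)

lemma in_rothe_diagram_iff:
  assumes "w \<in> S_infty"
  shows "(i, j) \<in> rothe_diagram w \<longleftrightarrow> 1 \<le> i \<and> j < w i \<and> (\<exists>p>i. w p = j)"
proof -
  have bij: "bij w" using assms by (auto simp: S_infty_def permutes_bij)
  have inv: "inv w (w p) = p" "w (inv w p) = p" for p
    using bij by (simp_all add: bij_is_inj bij_is_surj surj_f_inv_f)
  have "w p \<ge> 1" if "p > 0" for p
    using that S_infty_zero[OF assms] inv by (metis less_one linorder_not_less less_irrefl)
  then show ?thesis
    unfolding rothe_diagram_def using inv by auto
qed

lemma finite_rothe_diagram:
  assumes "w \<in> S_infty"
  shows "finite (rothe_diagram w)"
proof -
  obtain n where "w permutes {1..n}" using assms by (auto simp: S_infty_def)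
  then have "rothe_diagram w \<subseteq> {1..n} \<times> {1..n}" by (auto simp: rothe_diagram_bounded)
  then show ?thesis by (rule finite_subset) simp
qed

text \<open>
  The essential boxes are corners of the diagram, and starting from any box one reaches a corner by
  going right and down, as a box with maximal coordinate sum shows.
\<close>

lemma in_effective_region_iff:
  assumes "w \<in> S_infty"
  shows "(i, j) \<in> effective_region w \<longleftrightarrow>
    1 \<le> i \<and> 1 \<le> j \<and> (\<exists>(a, b)\<in>rothe_diagram w. i \<le> a \<and> j \<le> b)"
proof -
  have "\<exists>(a', b')\<in>essential_set w. a \<le> a' \<and> b \<le> b'" if ab: "(a, b) \<in> rothe_diagram w" for a b
  proof -
    let ?A = "{(a', b') \<in> rothe_diagram w. a \<le> a' \<and> b \<le> b'}"
    have fin: "finite ?A" by (rule finite_subset[OF _ finite_rothe_diagram[OF assms]]) auto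
    have "?A \<noteq> {}" using ab by auto
    then obtain x where x: "x \<in> ?A" "\<And>y. y \<in> ?A \<Longrightarrow> fst y + snd y \<le> fst x + snd x"
      using finite_has_maximal[of "(\<lambda>y. fst y + snd y) ` ?A"] fin
      by (smt (verit) finite_imageI image_iff image_is_empty nle_le)
    obtain a' b' where x': "x = (a', b')" by (cases x)
    have "(a', b' + 1) \<notin> rothe_diagram w" "(a' + 1, b') \<notin> rothe_diagram w"
      using x(1) x(2)[of "(a', b' + 1)"] x(2)[of "(a' + 1, b')"] x' by auto
    then show ?thesis using x(1) x' by (auto simp: essential_set_def)
  qed
  then show ?thesis
    unfolding effective_region_def by (fastforce simp: essential_set_def)
qed

lemma rothe_diagram_subset_effective_region:
  assumes "w \<in> S_infty"
  shows "rothe_diagram w \<subseteq> effective_region w"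
  by (auto simp: in_effective_region_iff[OF assms]) (auto simp: rothe_diagram_def)

lemma rothe_diagram_id: "rothe_diagram id = {}"
  by (auto simp: rothe_diagram_def)

lemma effective_region_id: "effective_region id = {}"
  by (auto simp: effective_region_def essential_set_def rothe_diagram_id)

section \<open>Diagrams in the transition formula\<close>

lemma transition_perm_apply:
  shows "transition_perm w (last_descent w) = w (last_smaller w)"
    and "transition_perm w (last_smaller w) = w (last_descent w)"
    and "p \<noteq> last_descent w \<Longrightarrow> p \<noteq> last_smaller w \<Longrightarrow> transition_perm w p = w p"
  by (auto simp: transition_perm_def transpose_def)

lemma increasing_after_last_descent:
  assumes "w \<in> S_infty" "w \<noteq> id" "last_descent w < i" "i < p"
  shows "w i < w p"
  using assms(4)
proof (induction p)
  case (Suc p)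
  have "w p < w (p + 1)" using last_descent(3)[OF assms(1,2)] Suc.prems assms(3) by simp
  then show ?case using Suc by (cases "i = p") auto
qed simp

lemma transition_perm_increasing_after_last_descent:
  assumes w: "w \<in> S_infty" "w \<noteq> id" and ip: "last_descent w < i" "i < p"
  shows "transition_perm w i < transition_perm w p"
proof -
  let ?m = "last_smaller w"
  note ls = last_smaller[OF w] and inc = increasing_after_last_descent[OF w]
    and val = transition_perm_apply[where w = w]
  consider "i = ?m" | "p = ?m" | "i \<noteq> ?m" "p \<noteq> ?m" by blast
  then show ?thesis
  proof cases
    case 1
    then show ?thesis using val(2) val(3)[of p] ls(3)[of p] ip by simp
  next
    case 2
    then show ?thesis using val(2) val(3)[of i] inc[of i ?m] ls(2) ip by simp
  next
    case 3
    then show ?thesis using val(3)[of i] val(3)[of p] inc[OF ip] ip by simp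
  qed
qed

lemma corner_in_rothe_diagram:
  assumes w: "w \<in> S_infty" "w \<noteq> id"
  shows "(last_descent w, transition_perm w (last_descent w)) \<in> rothe_diagram w"
  using last_descent(1)[OF w] last_smaller(1,2)[OF w] transition_perm_apply(1)[of w]
  by (auto simp: in_rothe_diagram_iff[OF w(1)])

text \<open>
  The swap of \<open>w g\<close> and \<open>w m\<close> affects the rows below \<open>g\<close> in neither diagram, since these are
  empty.  For a row above \<open>g\<close> both swapped positions come later, and only the set of later values
  matters.  In row \<open>g\<close> itself, the boxes are the values smaller than \<open>w g\<close> that occur later, and \<open>w m\<close> is the
  largest of them.
\<close>

lemma rothe_diagram_transition_perm:
  assumes w: "w \<in> S_infty" "w \<noteq> id"
  shows "rothe_diagram (transition_perm w) =
    rothe_diagram w - {(last_descent w, transition_perm w (last_descent w))}"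
proof -
  define g m where gm: "g = last_descent w" "m = last_smaller w"
  define w' where "w' = transition_perm w"
  have w': "w' \<in> S_infty" using transition_perm_in_S_infty[OF w] by (simp add: w'_def)
  note ls = last_smaller[OF w, folded gm]
  note inc = increasing_after_last_descent[OF w, folded gm]
  note inc' = transition_perm_increasing_after_last_descent[OF w, folded gm w'_def]
  note val = transition_perm_apply[where w = w, folded gm w'_def]
  note D = in_rothe_diagram_iff[OF w(1)] and D' = in_rothe_diagram_iff[OF w']
  have "(i, j) \<in> rothe_diagram w' \<longleftrightarrow> (i, j) \<in> rothe_diagram w \<and> (i, j) \<noteq> (g, w' g)" for i j
  proof (cases i g rule: linorder_cases)
    case less
    have later: "(\<exists>p>i. w' p = j) \<longleftrightarrow> (\<exists>p>i. w p = j)"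
    proof
      assume "\<exists>p>i. w' p = j"
      then obtain p where p: "p > i" "w' p = j" by blast
      then show "\<exists>p>i. w p = j"
        using less ls(1) val by (intro exI[of _ "transpose g m p"]) (auto simp: transpose_def)
    next
      assume "\<exists>p>i. w p = j"
      then obtain p where p: "p > i" "w p = j" by blast
      then show "\<exists>p>i. w' p = j"
        using less ls(1) val by (intro exI[of _ "transpose g m p"]) (auto simp: transpose_def)
    qed
    show ?thesis using less ls(1) val(3)[of i] by (simp add: D D' later)
  next
    case equal
    have "(\<exists>p>g. w' p = j \<and> j < w' g) \<longleftrightarrow> (\<exists>p>g. w p = j \<and> j < w g \<and> j \<noteq> w' g)"
    proof
      assume "\<exists>p>g. w' p = j \<and> j < w' g"
      then obtain p where p: "p > g" "w' p = j" "j < w' g" by blast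
      then have "p \<noteq> m" using val ls(2) by auto
      then show "\<exists>p>g. w p = j \<and> j < w g \<and> j \<noteq> w' g"
        using p val ls(2) by (intro exI[of _ p]) auto
    next
      assume "\<exists>p>g. w p = j \<and> j < w g \<and> j \<noteq> w' g"
      then obtain p where p: "p > g" "w p = j" "j < w g" "j \<noteq> w' g" by blast
      have "p < m" using p val(1) ls(3)[of p] by (cases p m rule: linorder_cases) auto
      then show "\<exists>p>g. w' p = j \<and> j < w' g"
        using p val inc[of p m] by (intro exI[of _ p]) auto
    qed
    then show ?thesis using equal by (auto simp: D D')
  next
    case greater
    then show ?thesis using inc[of i] inc'[of i] by (fastforce simp: D D')
  qed
  then show ?thesis by (auto simp: w'_def gm)
qed

text \<open>
  The operators rotate values among the chosen positions and \<open>g\<close>.  Each chosen position \<open>i\<close>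
  still carries its original value \<open>r i < c\<close> when its transposition is applied, so any choice moves
  a value below \<open>c\<close> into position \<open>g\<close>, and only values up to \<open>c\<close> are moved.
\<close>

lemma transition_reach_values:
  assumes "v \<in> transition_reach g ks u" "sorted_wrt (<) ks"
    and "\<forall>i\<in>set ks. i < g \<and> u i = r i \<and> r i < c" "u g \<le> c"
    and "\<forall>i. u i = r i \<or> i \<le> g \<and> u i \<le> c"
  shows "(\<forall>i. v i = r i \<or> i \<le> g \<and> v i \<le> c) \<and> (v = u \<or> v g < c)"
  using assms
proof (induction ks arbitrary: u)
  case (Cons i ks)
  let ?u = "u \<circ> transpose i g"
  from Cons.prems(1) consider "v \<in> transition_reach g ks u" | "v \<in> transition_reach g ks ?u"
    by auto
  then show ?case
  proof cases
    case 1
    then show ?thesis using Cons.IH[of u] Cons.prems by simp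
  next
    case 2
    have "\<forall>k\<in>set ks. k < g \<and> ?u k = r k \<and> r k < c"
      using Cons.prems by (auto simp: transpose_def)
    moreover have ug: "?u g < c" using Cons.prems by (auto simp: transpose_def)
    moreover have "\<forall>k. ?u k = r k \<or> k \<le> g \<and> ?u k \<le> c"
      using Cons.prems by (auto simp: transpose_def)
    ultimately have "(\<forall>i. v i = r i \<or> i \<le> g \<and> v i \<le> c) \<and> (v = ?u \<or> v g < c)"
      using Cons.IH[OF 2] Cons.prems(2) less_imp_le[OF ug] by (metis sorted_wrt.simps(2))
    with ug show ?thesis by auto
  qed
qed simp

lemma start_in_transition_reach:
  "u \<in> transition_reach g ks u"
  by (induction ks) auto

lemma transition_reach_transition_indices:
  assumes w: "w \<in> S_infty" "w \<noteq> id"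
    and v: "v \<in> transition_reach (last_descent w) (transition_indices w) (transition_perm w)"
  defines "g \<equiv> last_descent w" and "w' \<equiv> transition_perm w"
  shows "v \<in> S_infty"
    and "v i = w' i \<or> i \<le> g \<and> v i \<le> w' g"
    and "v = w' \<or> v g < w' g"
proof -
  show "v \<in> S_infty"
    using transition_reach_props[OF v transition_perm_in_S_infty[OF w] sorted_transition_indices,
        of w' "w' g"] transition_indices_less[OF w] by (simp add: w'_def g_def)
  have "(\<forall>i. v i = w' i \<or> i \<le> g \<and> v i \<le> w' g) \<and> (v = w' \<or> v g < w' g)"
    using transition_reach_values[OF v sorted_transition_indices, of w' "w' g"]
      transition_indices_less[OF w] by (simp add: w'_def g_def)
  then show "v i = w' i \<or> i \<le> g \<and> v i \<le> w' g" "v = w' \<or> v g < w' g" by auto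
qed

text \<open>
  Boxes right of column \<open>c = w' g\<close> only depend on values greater than \<open>c\<close>, and these have the same
  positions in \<open>v\<close> and in \<open>w'\<close>.
\<close>

lemma rothe_diagram_transition_reach:
  assumes w: "w \<in> S_infty" "w \<noteq> id"
    and v: "v \<in> transition_reach (last_descent w) (transition_indices w) (transition_perm w)"
    and ij: "(i, j) \<in> rothe_diagram v"
  defines "g \<equiv> last_descent w" and "w' \<equiv> transition_perm w"
  shows "i \<le> g" and "j \<le> w' g \<or> (i, j) \<in> rothe_diagram w'"
    and "i = g \<Longrightarrow> j < v g"
proof -
  note vS = transition_reach_transition_indices(1)[OF w v]
  note val = transition_reach_transition_indices(2)[OF w v, folded g_def w'_def]
  have w': "w' \<in> S_infty" using transition_perm_in_S_infty[OF w] by (simp add: w'_def)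
  note inc' = transition_perm_increasing_after_last_descent[OF w, folded g_def w'_def]
  obtain p where p: "1 \<le> i" "i < p" "v p = j" "j < v i"
    using ij by (auto simp: in_rothe_diagram_iff[OF vS])
  show "i \<le> g"
  proof (rule ccontr)
    assume "\<not> i \<le> g"
    then show False using inc'[of i p] val[of i] val[of p] p by auto
  qed
  show "j \<le> w' g \<or> (i, j) \<in> rothe_diagram w'"
    using p val[of i] val[of p] by (auto simp: in_rothe_diagram_iff[OF w'])
  show "j < v g" if "i = g" using p that by simp
qed

text \<open>
  Row \<open>g\<close> is the last row of \<open>D(v)\<close> that can be nonempty, and its boxes lie left of column
  \<open>v g \<le> c\<close>.  So \<open>\<lambda>(v)\<close> contains neither \<open>(g, c)\<close> nor, when \<open>v g < c\<close>, the cell \<open>(g, c - 1)\<close>.  This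
  cell does exist then, that is \<open>c > 1\<close>, because \<open>v g\<close> is positive.
\<close>

lemma effective_region_transition_reach:
  assumes w: "w \<in> S_infty" "w \<noteq> id"
    and v: "v \<in> transition_reach (last_descent w) (transition_indices w) (transition_perm w)"
  defines "g \<equiv> last_descent w" and "w' \<equiv> transition_perm w"
  shows "effective_region v \<subseteq> effective_region w - {(g, w' g)}"
    and "v \<noteq> w' \<Longrightarrow> effective_region v \<subseteq> effective_region w - {(g, w' g), (g, w' g - 1)}"
    and "v \<noteq> w' \<Longrightarrow> (g, w' g - 1) \<in> effective_region w \<and> w' g - 1 \<noteq> w' g"
proof -
  note vS = transition_reach_transition_indices(1)[OF w v]
  note val = transition_reach_transition_indices(2,3)[OF w v, folded g_def w'_def]
  note D = rothe_diagram_transition_reach[OF w v, folded g_def w'_def]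
  note corner = corner_in_rothe_diagram[OF w, folded g_def w'_def]
  note D' = rothe_diagram_transition_perm[OF w, folded g_def w'_def]
  have vg: "v g \<le> w' g" using val(1)[of g] by auto
  have sub: "effective_region v \<subseteq> effective_region w"
  proof clarify
    fix a b assume "(a, b) \<in> effective_region v"
    then obtain i j where *: "1 \<le> a" "1 \<le> b" "(i, j) \<in> rothe_diagram v" "a \<le> i" "b \<le> j"
      by (auto simp: in_effective_region_iff[OF vS])
    have "(i, j) \<in> rothe_diagram w' \<Longrightarrow> (i, j) \<in> rothe_diagram w" using D' by blast
    then have "a \<le> g" "b \<le> w' g \<or> (i, j) \<in> rothe_diagram w"
      using D(1,2)[OF *(3)] *(4,5) by linarith+
    then show "(a, b) \<in> effective_region w"
      using * corner by (auto simp: in_effective_region_iff[OF w(1)])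
  qed
  have row_g: "b < v g" if "(g, b) \<in> effective_region v" for b
    using that D(1,3) by (fastforce simp: in_effective_region_iff[OF vS])
  show "effective_region v \<subseteq> effective_region w - {(g, w' g)}"
    using sub row_g vg by fastforce
  assume "v \<noteq> w'"
  then have less: "v g < w' g" using val(2) by blast
  show "effective_region v \<subseteq> effective_region w - {(g, w' g), (g, w' g - 1)}"
    using sub row_g less by fastforce
  have "g \<ge> 1" using last_descent(1)[OF w] by (simp add: g_def)
  have "v g \<noteq> 0"
    using inj_eq[OF S_infty_inj[OF vS], of g 0] S_infty_zero[OF vS] \<open>g \<ge> 1\<close> by simp
  then have "w' g - 1 \<ge> 1" using less by linarith
  then show "(g, w' g - 1) \<in> effective_region w \<and> w' g - 1 \<noteq> w' g"
    using corner \<open>g \<ge> 1\<close>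
    by (auto simp: in_effective_region_iff[OF w(1)] intro!: bexI[of _ "(g, w' g)"])
qed

lemma corner_in_effective_region:
  assumes w: "w \<in> S_infty" "w \<noteq> id"
  shows "(last_descent w, transition_perm w (last_descent w)) \<in> effective_region w"
  using corner_in_rothe_diagram[OF w] rothe_diagram_subset_effective_region[OF w(1)] by blast

lemma card_effective_region_transition_reach:
  assumes w: "w \<in> S_infty" "w \<noteq> id"
    and v: "v \<in> transition_reach (last_descent w) (transition_indices w) (transition_perm w)"
  shows "card (effective_region v) + 1 \<le> card (effective_region w)"
proof -
  note fin = finite_effective_region[OF w(1)]
  have "card (effective_region v) < card (effective_region w)"
    using effective_region_transition_reach(1)[OF w v] corner_in_effective_region[OF w]
    by (intro psubset_card_mono fin) auto
  then show ?thesis by simp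
qed

text \<open>
  For \<open>v = w'\<close> the strictness comes from a cell of \<open>\<lambda>(w)\<close> outside \<open>D(w)\<close>, which \<open>\<lambda>(w') = D(w')\<close> cannot
  contain; for every other \<open>v\<close> it comes from the cell left of the corner.
\<close>

lemma card_effective_region_transition_reach_dominant:
  assumes w: "w \<in> S_infty" "w \<noteq> id" "\<not> dominant w"
    and v: "v \<in> transition_reach (last_descent w) (transition_indices w) (transition_perm w)"
      "dominant v"
  shows "card (effective_region v) + 1 < card (effective_region w)"
proof -
  define c where "c = (last_descent w, transition_perm w (last_descent w))"
  note fin = finite_effective_region[OF w(1)]
  note cw = corner_in_effective_region[OF w(1,2), folded c_def]
  have "effective_region v \<subset> effective_region w - {c}"
  proof (cases "v = transition_perm w")
    case True
    have "rothe_diagram v = rothe_diagram w - {c}"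
      unfolding True c_def by (rule rothe_diagram_transition_perm[OF w(1,2)])
    then have "effective_region v = rothe_diagram w - {c}"
      using v(2) unfolding dominant_def by (rule trans[rotated])
    moreover have "rothe_diagram w \<subset> effective_region w"
      using rothe_diagram_subset_effective_region[OF w(1)] w(3) by (auto simp: dominant_def)
    ultimately show ?thesis
      using corner_in_rothe_diagram[OF w(1,2), folded c_def] by blast
  next
    case False
    show ?thesis
      using effective_region_transition_reach(2,3)[OF w(1,2) v(1) False] unfolding c_def by blast
  qed
  then have "card (effective_region v) < card (effective_region w - {c})"
    using fin by (intro psubset_card_mono) auto
  also have "card (effective_region w - {c}) = card (effective_region w) - 1"
    using cw by (rule card_Diff_singleton)
  finally show ?thesis by simp
qed

lemma dominant_transition_perm:
  assumes w: "w \<in> S_infty" "w \<noteq> id" "dominant w"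
  shows "dominant (transition_perm w)"
    and "card (effective_region w) = card (effective_region (transition_perm w)) + 1"
proof -
  define c where "c = (last_descent w, transition_perm w (last_descent w))"
  note cw = corner_in_effective_region[OF w(1,2), folded c_def]
  have D: "rothe_diagram (transition_perm w) = effective_region w - {c}"
    using rothe_diagram_transition_perm[OF w(1,2), folded c_def] w(3)
    unfolding dominant_def by metis
  have "effective_region (transition_perm w) \<subseteq> effective_region w - {c}"
    unfolding c_def
    by (rule effective_region_transition_reach(1)[OF w(1,2) start_in_transition_reach])
  with rothe_diagram_subset_effective_region[OF transition_perm_in_S_infty[OF w(1,2)]] D
  have E: "effective_region (transition_perm w) = effective_region w - {c}" by blast
  then show "dominant (transition_perm w)" unfolding dominant_def D .
  from E show "card (effective_region w) = card (effective_region (transition_perm w)) + 1"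
    using cw finite_effective_region[OF w(1)]
    by (metis Suc_eq_plus1 card_Suc_Diff1)
qed

text \<open>
  Seen as patterns: an index \<open>i\<close> would give \<open>w i < w m < w g\<close> at positions \<open>i < g < m\<close>, whereas dominant
  permutations avoid 132.
\<close>

lemma dominant_transition_indices:
  assumes w: "w \<in> S_infty" "w \<noteq> id" "dominant w"
  shows "transition_indices w = []"
proof (rule ccontr)
  let ?g = "last_descent w"
  assume "transition_indices w \<noteq> []"
  then obtain i where "i \<in> set (transition_indices w)" by (meson list.set_sel(1))
  note i = transition_indices_less[OF w(1,2) this]
  then have "transition_perm w i = w i"
    using last_smaller(1)[OF w(1,2)] transition_perm_apply(3)[where w = w] by simp
  with i(3) have less: "w i < transition_perm w ?g" by simp
  have "w i \<noteq> 0"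
    using inj_eq[OF S_infty_inj[OF w(1)], of i 0] S_infty_zero[OF w(1)] i(1) by simp
  then have "(i, w i) \<in> effective_region w"
    using i less corner_in_rothe_diagram[OF w(1,2)]
    by (auto simp: in_effective_region_iff[OF w(1)]
        intro!: bexI[of _ "(?g, transition_perm w ?g)"])
  then show False using w(3) by (simp add: dominant_def rothe_diagram_def)
qed

section \<open>Degrees of Grothendieck polynomials\<close>

text \<open>
  The permutation \<open>w'\<close> is itself one of the \<open>v\<close>, so a single induction hypothesis covers both terms of
  the transition formula.
\<close>

lemma transition_induct [consumes 1, case_names id transition]:
  assumes "w \<in> S_infty" "P id"
    and "\<And>w. w \<in> S_infty \<Longrightarrow> w \<noteq> id \<Longrightarrow>
      (\<And>v. v \<in> transition_reach (last_descent w) (transition_indices w) (transition_perm w) \<Longrightarrow> P v)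
      \<Longrightarrow> P w"
  shows "P w"
  using assms(1)
proof (induction w rule: grothendieck.induct)
  case (1 w)
  show ?case
  proof (cases "w = id")
    case True
    show ?thesis unfolding True by (rule assms(2))
  next
    case False
    show ?thesis
      by (rule assms(3)[OF 1(3) False])
        (use 1(2) 1(3) False transition_reach_transition_indices(1)[OF 1(3) False] in blast)
  qed
qed

lemma grothendieck_dominant:
  assumes "w \<in> S_infty" "dominant w"
  shows "\<exists>m. grothendieck w = Poly_Mapping.single m 1 \<and>
    monomial_degree m = card (effective_region w)"
  using assms
proof (induction w rule: transition_induct)
  case id
  show ?case
    unfolding grothendieck_id effective_region_id
    by (intro exI[of _ 0]) (simp add: monomial_degree_def)
next
  case (transition w)
  let ?w' = "transition_perm w" and ?g = "last_descent w"
  obtain m where m: "grothendieck ?w' = Poly_Mapping.single m 1"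
    "monomial_degree m = card (effective_region ?w')"
    using transition.IH[OF start_in_transition_reach]
      dominant_transition_perm(1)[OF transition.hyps transition.prems] by blast
  have "grothendieck w = mvar ?g * grothendieck ?w'"
    using grothendieck_transition[OF transition.hyps]
    by (simp add: dominant_transition_indices[OF transition.hyps transition.prems] algebra_simps)
  also have "\<dots> = Poly_Mapping.single (Poly_Mapping.single ?g 1 + m) 1"
    by (simp add: m mvar_def mult_single)
  finally show ?case
    using m(2) dominant_transition_perm(2)[OF transition.hyps transition.prems]
    by (intro exI[of _ "Poly_Mapping.single ?g 1 + m"]) (simp add: monomial_degree_add)
qed

lemma total_degree_grothendieck_dominant:
  assumes "w \<in> S_infty" "dominant w"
  shows "total_degree (grothendieck w) = card (effective_region w)"
  using grothendieck_dominant[OF assms] total_degree_single by metis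

lemma total_degree_grothendieck_not_dominant:
  assumes "w \<in> S_infty" "\<not> dominant w"
  shows "total_degree (grothendieck w) < card (effective_region w)"
  using assms
proof (induction w rule: transition_induct)
  case id
  then show ?case unfolding dominant_def rothe_diagram_id effective_region_id by blast
next
  case (transition w)
  let ?w' = "transition_perm w" and ?g = "last_descent w" and ?ks = "transition_indices w"
  have less: "total_degree (grothendieck v) + 1 < card (effective_region w)"
    if v: "v \<in> transition_reach ?g ?ks ?w'" for v
  proof (cases "dominant v")
    case True
    then show ?thesis
      using total_degree_grothendieck_dominant
        transition_reach_transition_indices(1)[OF transition.hyps v]
        card_effective_region_transition_reach_dominant[OF transition.hyps transition.prems v]
      by simp
  next
    case False
    then show ?thesis
      using transition.IH[OF v] card_effective_region_transition_reach[OF transition.hyps v]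
      by simp
  qed
  \<comment> \<open>The bound above also shows that \<open>\<lambda>(w)\<close> has at least two cells, so this is no truncation.\<close>
  define d where "d = card (effective_region w) - 2"
  have le: "total_degree (grothendieck v) \<le> d" if "v \<in> transition_reach ?g ?ks ?w'" for v
    using less[OF that] by (simp add: d_def)
  have d: "card (effective_region w) = d + 2"
    using less[OF start_in_transition_reach] by (simp add: d_def)
  have "total_degree ((mvar ?g - 1) * transition_op ?g ?ks grothendieck ?w') \<le> 1 + d"
    by (intro total_degree_mult_le total_degree_mvar_minus_one total_degree_transition_op_le le)
  moreover have "total_degree (grothendieck ?w') \<le> 1 + d"
    using le[OF start_in_transition_reach] by simp
  ultimately have "total_degree (grothendieck w) \<le> 1 + d"
    unfolding grothendieck_transition[OF transition.hyps] by (intro total_degree_add_le)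
  then show ?case using d by simp
qed

theorem proposition4p1:
  fixes w :: perm
  assumes "w \<in> S_infty"
  shows "total_degree (grothendieck w) \<le> card (effective_region w) \<and>
         (total_degree (grothendieck w) = card (effective_region w) \<longleftrightarrow> dominant w)"
  using total_degree_grothendieck_dominant[OF assms]
    total_degree_grothendieck_not_dominant[OF assms] by (cases "dominant w") auto

end
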